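(* Let $\mathcal H$ be a Hilbert space of infinite dimension. Then every normal positive linear map $\psi:\mathcal B(\mathcal H)\rightarrow\mathcal B(\mathcal K)$ (with $\mathcal K$ a Hilbert space) is Toeplitz completely positive.
   Context: $\mathcal B(\mathcal H)$ denotes the algebra of all bounded linear operators on the complex Hilbert space $\mathcal H$. "Normal" means continuous with respect to the ultraweak topologies. If $\mathcal R$ is an operator system, a linear map $\psi:\mathcal R\rightarrow\mathcal B(\mathcal K)$ is Toeplitz completely positive if, for every $n\in\mathbb N$ and all $\tau_{-n+1},\dots,\tau_{n-1}\in\mathcal R$ such that the Toeplitz matrix $[\tau_{k-j}]_{k,j=1}^n$ belongs to the positive cone $\mathcal M_n(\mathcal R)_+$, the matrix $[\psi(\tau_{k-j})]_{k,j=1}^n$ is a positive operator on $\bigoplus_1^n\mathcal K$. For $\mathcal R=\mathcal B(\mathcal H)$, $\mathcal M_n(\mathcal R)_+$ is the set of $n\times n$ operator matrices that are positive operators on $\bigoplus_1^n\mathcal H$. *)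

theory Defs
  imports "HOL-Analysis.Analysis"
begin

class complex_hilbert_space = banach +
  fixes scaleC :: "complex \<Rightarrow> 'a \<Rightarrow> 'a"  (infixr "*\<^sub>C" 75)
    and cinner :: "'a \<Rightarrow> 'a \<Rightarrow> complex"
  assumes scaleC_add_right: "c *\<^sub>C (x + y) = c *\<^sub>C x + c *\<^sub>C y"
    and scaleC_add_left: "(c + d) *\<^sub>C x = c *\<^sub>C x + d *\<^sub>C x"
    and scaleC_scaleC: "c *\<^sub>C d *\<^sub>C x = (c * d) *\<^sub>C x"
    and scaleC_of_real: "complex_of_real r *\<^sub>C x = r *\<^sub>R x"
    and cinner_commute: "cinner x y = cnj (cinner y x)"
    and cinner_add_right: "cinner x (y + z) = cinner x y + cinner x z"
    and cinner_scaleC_right: "cinner x (c *\<^sub>C y) = c * cinner x y"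
    and cinner_self: "cinner x x = complex_of_real ((norm x)\<^sup>2)"

lemma vector_space_scaleC:
  "vector_space (scaleC :: complex \<Rightarrow> 'h::complex_hilbert_space \<Rightarrow> 'h)"
proof
  show "1 *\<^sub>C x = x" for x :: 'h
    using scaleC_of_real[of 1 x] by simp
qed (rule scaleC_add_right scaleC_add_left scaleC_scaleC)+

global_interpretation complex_hilbert: vector_space
  "scaleC :: complex \<Rightarrow> 'h::complex_hilbert_space \<Rightarrow> 'h"
  by (rule vector_space_scaleC)

definition infinite_dimensional :: "'h::complex_hilbert_space itself \<Rightarrow> bool" where
  "infinite_dimensional _ \<longleftrightarrow>
     \<not> (\<exists>B. finite_dimensional_vector_space (scaleC :: complex \<Rightarrow> 'h \<Rightarrow> 'h) B)"

text \<open>The type \<open>'h bop\<close> is the space of all bounded complex-linear operators on \<open>'h\<close>.\<close>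

typedef (overloaded) 'h bop =
  "{A :: 'h::complex_hilbert_space \<Rightarrow> 'h. bounded_linear A \<and> (\<forall>c x. A (c *\<^sub>C x) = c *\<^sub>C A x)}"
  morphisms bop_apply Bop
proof
  show "(\<lambda>_. 0) \<in> {A :: 'h \<Rightarrow> 'h. bounded_linear A \<and> (\<forall>c x. A (c *\<^sub>C x) = c *\<^sub>C A x)}"
    by (simp add: bounded_linear_zero)
qed

setup_lifting type_definition_bop

lemma bop_eqI: "(\<And>x. bop_apply A x = bop_apply B x) \<Longrightarrow> A = B"
  by (simp add: bop_apply_inject[symmetric] fun_eq_iff)

instantiation bop :: (complex_hilbert_space) ab_group_add
begin

lift_definition zero_bop :: "'a bop" is "\<lambda>_. 0"
  by (simp add: bounded_linear_zero)

lift_definition plus_bop :: "'a bop \<Rightarrow> 'a bop \<Rightarrow> 'a bop" is "\<lambda>A B x. A x + B x"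
  by (simp add: bounded_linear_add complex_hilbert.scale_right_distrib)

lift_definition uminus_bop :: "'a bop \<Rightarrow> 'a bop" is "\<lambda>A x. - A x"
  by (simp add: bounded_linear_minus)

lift_definition minus_bop :: "'a bop \<Rightarrow> 'a bop \<Rightarrow> 'a bop" is "\<lambda>A B x. A x - B x"
  by (simp add: bounded_linear_sub complex_hilbert.scale_right_diff_distrib)

instance
  by standard (transfer; force simp: fun_eq_iff)+

end

lemma bounded_linear_scaleC: "bounded_linear (\<lambda>x::'h::complex_hilbert_space. c *\<^sub>C x)"
proof (rule bounded_linear_intro[where K = "cmod c"])
  fix x y :: 'h and r :: real
  show "c *\<^sub>C (x + y) = c *\<^sub>C x + c *\<^sub>C y"
    by (rule scaleC_add_right)
  show "c *\<^sub>C r *\<^sub>R x = r *\<^sub>R c *\<^sub>C x"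
    by (simp add: scaleC_of_real[symmetric] scaleC_scaleC mult.commute)
  have left: "cinner (c *\<^sub>C x) (c *\<^sub>C x) = (c * cnj c) * cinner x x"
    by (metis cinner_commute cinner_scaleC_right complex_cnj_mult mult.assoc)
  have "complex_of_real ((norm (c *\<^sub>C x))\<^sup>2) = complex_of_real ((norm x * cmod c)\<^sup>2)"
    using left unfolding cinner_self complex_norm_square[symmetric]
    by (simp add: power_mult_distrib mult.commute)
  then have "(norm (c *\<^sub>C x))\<^sup>2 = (norm x * cmod c)\<^sup>2"
    by (simp only: of_real_eq_iff)
  then show "norm (c *\<^sub>C x) \<le> norm x * cmod c"
    by (simp add: power2_eq_iff_nonneg)
qed

lift_definition scaleC_bop :: "complex \<Rightarrow> 'h::complex_hilbert_space bop \<Rightarrow> 'h bop"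
  is "\<lambda>c A x. c *\<^sub>C A x"
  by (simp add: bounded_linear_compose[OF bounded_linear_scaleC] complex_hilbert.scale_left_commute)

lemma vector_space_bop: "vector_space scaleC_bop"
  by unfold_locales
    (transfer; simp add: fun_eq_iff complex_hilbert.scale_right_distrib
       complex_hilbert.scale_left_distrib)+

definition positive_bop :: "'h::complex_hilbert_space bop \<Rightarrow> bool" where
  "positive_bop A \<longleftrightarrow> (\<forall>x. cinner x (bop_apply A x) \<in> \<real>\<^sub>\<ge>\<^sub>0)"

definition positive_linear_map ::
  "('h::complex_hilbert_space bop \<Rightarrow> 'k::complex_hilbert_space bop) \<Rightarrow> bool" where
  "positive_linear_map \<psi> \<longleftrightarrow>
     Vector_Spaces.linear scaleC_bop scaleC_bop \<psi> \<and>
     (\<forall>A. positive_bop A \<longrightarrow> positive_bop (\<psi> A))"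

text \<open>The ultraweak topology is the coarsest topology making all functionals
  \<open>A \<mapsto> \<Sum>n. \<langle>x\<^sub>n, A y\<^sub>n\<rangle>\<close> with square-summable sequences \<open>x\<close>, \<open>y\<close> continuous.\<close>

definition square_summable :: "(nat \<Rightarrow> 'h::complex_hilbert_space) \<Rightarrow> bool" where
  "square_summable x \<longleftrightarrow> summable (\<lambda>n. (norm (x n))\<^sup>2)"

definition ultraweak_functional ::
  "(nat \<Rightarrow> 'h::complex_hilbert_space) \<Rightarrow> (nat \<Rightarrow> 'h) \<Rightarrow> 'h bop \<Rightarrow> complex" where
  "ultraweak_functional x y A = (\<Sum>n. cinner (x n) (bop_apply A (y n)))"

definition ultraweak_topology :: "'h::complex_hilbert_space bop topology" where
  "ultraweak_topology = topology_generated_by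
     {ultraweak_functional x y -` U | x y U. square_summable x \<and> square_summable y \<and> open U}"

lemma topspace_ultraweak [simp]:
  "topspace (ultraweak_topology :: 'h::complex_hilbert_space bop topology) = UNIV"
proof -
  have "square_summable (\<lambda>_. 0 :: 'h)"
    by (simp add: square_summable_def)
  then have "UNIV \<in> {ultraweak_functional x y -` U | x (y :: nat \<Rightarrow> 'h) U.
      square_summable x \<and> square_summable y \<and> open U}"
    using open_UNIV by blast
  then show ?thesis
    by (auto simp: ultraweak_topology_def)
qed

definition normal_map ::
  "('h::complex_hilbert_space bop \<Rightarrow> 'k::complex_hilbert_space bop) \<Rightarrow> bool" where
  "normal_map \<psi> \<longleftrightarrow> continuous_map ultraweak_topology ultraweak_topology \<psi>"

text \<open>Vectors of the \<open>n\<close>-fold direct sum of \<open>'h\<close> are functions on \<open>nat\<close> of which only the values on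
  \<open>{1..n}\<close> matter; similarly, only the entries of an operator matrix with indices in \<open>{1..n}\<close> matter.\<close>

definition dsum_cinner ::
  "nat \<Rightarrow> (nat \<Rightarrow> 'h::complex_hilbert_space) \<Rightarrow> (nat \<Rightarrow> 'h) \<Rightarrow> complex" where
  "dsum_cinner n \<xi> \<eta> = (\<Sum>k=1..n. cinner (\<xi> k) (\<eta> k))"

definition opmatrix_apply ::
  "nat \<Rightarrow> (nat \<Rightarrow> nat \<Rightarrow> 'h::complex_hilbert_space bop) \<Rightarrow> (nat \<Rightarrow> 'h) \<Rightarrow> nat \<Rightarrow> 'h" where
  "opmatrix_apply n M \<xi> k = (\<Sum>j=1..n. bop_apply (M k j) (\<xi> j))"

definition positive_opmatrix ::
  "nat \<Rightarrow> (nat \<Rightarrow> nat \<Rightarrow> 'h::complex_hilbert_space bop) \<Rightarrow> bool" where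
  "positive_opmatrix n M \<longleftrightarrow> (\<forall>\<xi>. dsum_cinner n \<xi> (opmatrix_apply n M \<xi>) \<in> \<real>\<^sub>\<ge>\<^sub>0)"

definition toeplitz_matrix :: "(int \<Rightarrow> 'a) \<Rightarrow> nat \<Rightarrow> nat \<Rightarrow> 'a" where
  "toeplitz_matrix \<tau> k j = \<tau> (int k - int j)"

definition toeplitz_completely_positive ::
  "('h::complex_hilbert_space bop \<Rightarrow> 'k::complex_hilbert_space bop) \<Rightarrow> bool" where
  "toeplitz_completely_positive \<psi> \<longleftrightarrow>
     (\<forall>n\<ge>1. \<forall>\<tau>. positive_opmatrix n (toeplitz_matrix \<tau>) \<longrightarrow>
        positive_opmatrix n (toeplitz_matrix (\<lambda>i. \<psi> (\<tau> i))))"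

end

theory Submission
  imports Defs
begin

text \<open>After adding a small
  multiple of the identity to \<open>\<tau>\<^sub>0\<close>, a positive operator Toeplitz matrix extends to positive Toeplitz
  matrices of every larger size \<open>N\<close>, because a partial positive block matrix whose only
  unspecified entries are the two corners \<open>X\<close>, \<open>X\<^sup>*\<close> has a positive completion
  (\<open>X = B C\<^sup>-\<^sup>1 D\<close> with \<open>C\<close> the middle block). By Fejer averaging over the roots of unity \<open>z\<close> of order
  \<open>2N\<close>, the operators \<open>(1 - \<bar>d\<bar>/N) \<tau>\<^sub>d\<close> are then combinations \<open>\<Sum>\<^sub>z z\<^sup>d E\<^sub>z\<close> with \<open>E\<^sub>z\<close> positive. Any positive
  map \<open>\<psi>\<close> keeps the \<open>\<psi> E\<^sub>z\<close> positive, and \<open>[z\<^bsup>k-j\<^esup> \<psi> E\<^sub>z]\<close> is visibly a positive matrix. Let \<open>N \<rightarrow> \<infinity>\<close>.\<close>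

section \<open>Arithmetic of operators and of the inner product\<close>

lemma bounded_linear_bop_apply: "bounded_linear (bop_apply A)"
  using bop_apply[of A] by simp

lemma bop_apply_scaleC: "bop_apply A (c *\<^sub>C x) = c *\<^sub>C bop_apply A x"
  using bop_apply[of A] by simp

lemmas bop_apply_add = linear_add[OF bounded_linear.linear[OF bounded_linear_bop_apply]]
  and bop_apply_diff = linear_diff[OF bounded_linear.linear[OF bounded_linear_bop_apply]]
  and bop_apply_minus = linear_neg[OF bounded_linear.linear[OF bounded_linear_bop_apply]]
  and bop_apply_zero = linear_0[OF bounded_linear.linear[OF bounded_linear_bop_apply]]
  and bop_apply_sum = linear_sum[OF bounded_linear.linear[OF bounded_linear_bop_apply]]

lemma sum_bop_apply: "bop_apply (\<Sum>i\<in>S. A i) x = (\<Sum>i\<in>S. bop_apply (A i) x)"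
  by (induction S rule: infinite_finite_induct) (simp_all add: zero_bop.rep_eq plus_bop.rep_eq)

lemma bop_apply_Bop:
  assumes "bounded_linear A" "\<And>c x. A (c *\<^sub>C x) = c *\<^sub>C A x"
  shows "bop_apply (Bop A) = A"
  using assms by (simp add: Bop_inverse)

lemma cinner_add_left: "cinner (x + y) z = cinner x z + cinner y z"
  by (metis cinner_add_right cinner_commute complex_cnj_add)

lemma cinner_scaleC_left: "cinner (c *\<^sub>C x) y = cnj c * cinner x y"
  by (metis cinner_commute cinner_scaleC_right complex_cnj_mult)

lemma cinner_zero_right [simp]: "cinner x 0 = 0"
  using cinner_add_right[of x 0 0] by simp

lemma cinner_zero_left [simp]: "cinner 0 x = 0"
  using cinner_add_left[of 0 0 x] by simp

lemma cinner_minus_right: "cinner x (- y) = - cinner x y"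
  using cinner_add_right[of x y "- y"] by (simp add: eq_neg_iff_add_eq_0 add.commute)

lemma cinner_minus_left: "cinner (- x) y = - cinner x y"
  using cinner_add_left[of x "- x" y] by (simp add: eq_neg_iff_add_eq_0 add.commute)

lemma cinner_sum_right: "cinner x (\<Sum>i\<in>S. f i) = (\<Sum>i\<in>S. cinner x (f i))"
  by (induction S rule: infinite_finite_induct) (simp_all add: cinner_add_right)

lemma cinner_sum_left: "cinner (\<Sum>i\<in>S. f i) x = (\<Sum>i\<in>S. cinner (f i) x)"
  by (induction S rule: infinite_finite_induct) (simp_all add: cinner_add_left)

text \<open>The expansion of the square behind both the contraction estimate and the weighted Young
  inequality further down.\<close>

lemma norm_diff_scaleR_sq:
  fixes x y :: "'h::complex_hilbert_space"
  shows "(norm (x - r *\<^sub>R y))\<^sup>2 = (norm x)\<^sup>2 - 2 * r * Re (cinner x y) + r\<^sup>2 * (norm y)\<^sup>2"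
proof -
  have nn: "(norm z)\<^sup>2 = Re (cinner z z)" for z :: 'h
    by (simp add: cinner_self)
  have e: "x - r *\<^sub>R y = x + complex_of_real (- r) *\<^sub>C y"
    by (simp only: scaleC_of_real) simp
  have "cinner (x - r *\<^sub>R y) (x - r *\<^sub>R y)
      = cinner x x - r * cinner x y - r * cinner y x + r * r * cinner y y"
    unfolding e
    by (simp only: cinner_add_left cinner_add_right cinner_scaleC_left cinner_scaleC_right)
      (simp add: algebra_simps)
  then have "(norm (x - r *\<^sub>R y))\<^sup>2
      = Re (cinner x x - r * cinner x y - r * cinner y x + r * r * cinner y y)"
    by (simp only: nn)
  moreover have "Re (cinner y x) = Re (cinner x y)"
    by (subst cinner_commute) simp
  ultimately show ?thesis
    by (simp add: power2_eq_square[of r] algebra_simps flip: nn)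
qed

section \<open>Sesquilinear forms of operator matrices\<close>

text \<open>Arbitrary index sets, with everything off \<open>I\<close> ignored, allow a matrix to be
  cut down to a block or bordered by a row and column without reindexing.\<close>

definition sform ::
  "'i set \<Rightarrow> ('i \<Rightarrow> 'i \<Rightarrow> 'h::complex_hilbert_space bop) \<Rightarrow> ('i \<Rightarrow> 'h) \<Rightarrow> ('i \<Rightarrow> 'h) \<Rightarrow> complex" where
  "sform I M u v = (\<Sum>k\<in>I. \<Sum>j\<in>I. cinner (u k) (bop_apply (M k j) (v j)))"

lemma sform_cong:
  assumes "\<And>k. k \<in> I \<Longrightarrow> u k = u' k" "\<And>k. k \<in> I \<Longrightarrow> v k = v' k"
    "\<And>k j. k \<in> I \<Longrightarrow> j \<in> I \<Longrightarrow> M k j = M' k j"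
  shows "sform I M u v = sform I M' u' v'"
  unfolding sform_def by (intro sum.cong refl) (simp add: assms)

lemma sform_add_left: "sform I M (\<lambda>k. u k + v k) w = sform I M u w + sform I M v w"
  by (simp add: sform_def cinner_add_left sum.distrib)

lemma sform_add_right: "sform I M w (\<lambda>k. u k + v k) = sform I M w u + sform I M w v"
  by (simp add: sform_def cinner_add_right bop_apply_add sum.distrib)

lemma sform_scaleC_left: "sform I M (\<lambda>k. c *\<^sub>C u k) w = cnj c * sform I M u w"
  by (simp add: sform_def cinner_scaleC_left sum_distrib_left)

lemma sform_scaleC_right: "sform I M w (\<lambda>k. c *\<^sub>C u k) = c * sform I M w u"
  by (simp add: sform_def cinner_scaleC_right bop_apply_scaleC sum_distrib_left)

lemma sform_minus_left: "sform I M (\<lambda>k. - u k) w = - sform I M u w"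
  by (simp add: sform_def cinner_minus_left sum_negf)

lemma sform_minus_right: "sform I M w (\<lambda>k. - u k) = - sform I M w u"
  by (simp add: sform_def cinner_minus_right bop_apply_minus sum_negf)

definition positive_on :: "'i set \<Rightarrow> ('i \<Rightarrow> 'i \<Rightarrow> 'h::complex_hilbert_space bop) \<Rightarrow> bool" where
  "positive_on I M \<longleftrightarrow> (\<forall>u. sform I M u u \<in> \<real>\<^sub>\<ge>\<^sub>0)"

lemma positive_opmatrix_iff: "positive_opmatrix n M \<longleftrightarrow> positive_on {1..n} M"
  by (simp add: positive_opmatrix_def positive_on_def dsum_cinner_def opmatrix_apply_def sform_def
      cinner_sum_right)

text \<open>Polarization: the form is real on the diagonal, in particular at \<open>u + v\<close>
  and at \<open>u + \<i> v\<close>; these two values settle the imaginary and the real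
  parts.\<close>

lemma sform_hermitian:
  assumes "positive_on I M"
  shows "sform I M v u = cnj (sform I M u v)"
proof -
  have im: "Im (sform I M w w) = 0" for w
    using assms by (auto simp: positive_on_def complex_nonneg_Reals_iff)
  have "Im (sform I M (\<lambda>k. u k + v k) (\<lambda>k. u k + v k)) = 0"
    "Im (sform I M (\<lambda>k. u k + \<i> *\<^sub>C v k) (\<lambda>k. u k + \<i> *\<^sub>C v k)) = 0"
    by (rule im)+
  then show ?thesis
    by (simp add: sform_add_left sform_add_right sform_scaleC_left sform_scaleC_right im
        complex_eq_iff)
qed

lemma sform_insert:
  assumes "finite I" "a \<notin> I"
  shows "sform (insert a I) M u v = cinner (u a) (bop_apply (M a a) (v a))
    + (\<Sum>j\<in>I. cinner (u a) (bop_apply (M a j) (v j)))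
    + (\<Sum>k\<in>I. cinner (u k) (bop_apply (M k a) (v a))) + sform I M u v"
  using assms by (simp add: sform_def sum.distrib algebra_simps)

text \<open>Hermitian symmetry, tested on a vector supported at \<open>a\<close> and one vanishing
  there. It lets row \<open>a\<close> act as the adjoint of column \<open>a\<close> although
  operator adjoints are never constructed.\<close>

lemma positive_on_row_column:
  assumes "finite I" "a \<notin> I" "positive_on (insert a I) M"
  shows "(\<Sum>j\<in>I. cinner x (bop_apply (M a j) (v j)))
    = cnj (\<Sum>k\<in>I. cinner (v k) (bop_apply (M k a) x))"
proof -
  let ?e = "\<lambda>k. if k = a then x else 0" and ?v = "\<lambda>k. if k = a then 0 else v k"
  have ne: "k \<noteq> a" if "k \<in> I" for k
    using that assms by auto
  have "sform (insert a I) M ?e ?v = (\<Sum>j\<in>I. cinner x (bop_apply (M a j) (v j)))"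
    using assms ne by (simp add: sform_insert bop_apply_zero) (simp add: sform_def ne cong: sum.cong)
  moreover have "sform (insert a I) M ?v ?e = (\<Sum>k\<in>I. cinner (v k) (bop_apply (M k a) x))"
    using assms ne
    by (simp add: sform_insert bop_apply_zero)
       (simp add: sform_def ne bop_apply_zero cong: sum.cong)
  ultimately show ?thesis
    using sform_hermitian[OF assms(3)] by metis
qed

lemma positive_on_subset:
  fixes M :: "'i \<Rightarrow> 'i \<Rightarrow> 'h::complex_hilbert_space bop"
  assumes "positive_on J M" "finite J" "I \<subseteq> J"
  shows "positive_on I M"
  unfolding positive_on_def
proof
  fix v :: "'i \<Rightarrow> 'h"
  let ?v = "\<lambda>k. if k \<in> I then v k else 0"
  have "sform J M ?v ?v = (\<Sum>k\<in>J. if k \<in> I then \<Sum>j\<in>J. if j \<in> I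
      then cinner (v k) (bop_apply (M k j) (v j)) else 0 else 0)"
    unfolding sform_def by (intro sum.cong) (auto simp: bop_apply_zero intro!: sum.cong)
  also have "\<dots> = sform I M v v"
    using assms by (simp add: sform_def Int_absorb1 flip: sum.inter_restrict)
  finally show "sform I M v v \<in> \<real>\<^sub>\<ge>\<^sub>0"
    using assms(1) by (metis positive_on_def)
qed

section \<open>Inverting a positive definite block and completing a partial positive matrix\<close>

text \<open>Lax-Milgram by iteration: as the matrix \<open>A\<close> is bounded and coercive,
  \<open>u - \<rho> (A u - f)\<close> contracts for a suitable \<open>\<rho>\<close>, and its
  iterates from zero converge to the solution. Convergence is taken component by component on
  \<open>I\<close>.\<close>

lemma positive_definite_solution:
  fixes M :: "'i \<Rightarrow> 'i \<Rightarrow> 'h::complex_hilbert_space bop"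
  assumes fin: "finite I" and \<epsilon>: "\<epsilon> > 0"
    and low: "\<And>u. \<epsilon> * (\<Sum>k\<in>I. (norm (u k))\<^sup>2) \<le> Re (sform I M u u)"
  shows "\<exists>u. \<forall>k\<in>I. (\<Sum>j\<in>I. bop_apply (M k j) (u j)) = f k"
proof -
  define A where "A u k = (\<Sum>j\<in>I. bop_apply (M k j) (u j))" for u k
  define N where "N u = (\<Sum>k\<in>I. (norm (u k))\<^sup>2)" for u :: "'i \<Rightarrow> 'h"
  have N0: "N u \<ge> 0" for u
    by (simp add: N_def sum_nonneg)
  have "\<exists>K. \<forall>u. N (A u) \<le> K * N u"
  proof -
    have "\<exists>K\<ge>0. \<forall>x. norm (bop_apply (M k j) x) \<le> norm x * K" for k j
      using bounded_linear.nonneg_bounded[OF bounded_linear_bop_apply] by blast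
    then obtain B where B: "B k j \<ge> 0" "norm (bop_apply (M k j) x) \<le> norm x * B k j" for k j x
      by metis
    have "N (A u) \<le> (\<Sum>k\<in>I. \<Sum>j\<in>I. (B k j)\<^sup>2) * N u" for u
    proof -
      have "(norm (A u k))\<^sup>2 \<le> (\<Sum>j\<in>I. (B k j)\<^sup>2) * N u" for k
      proof -
        have "norm (A u k) \<le> (\<Sum>j\<in>I. B k j * norm (u j))"
          unfolding A_def by (rule sum_norm_le) (metis B(2) mult.commute)
        then have "(norm (A u k))\<^sup>2 \<le> (\<Sum>j\<in>I. B k j * norm (u j))\<^sup>2"
          by (rule power_mono) simp
        also have "\<dots> \<le> (\<Sum>j\<in>I. (B k j)\<^sup>2) * N u"
          unfolding N_def by (rule Cauchy_Schwarz_ineq_sum)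
        finally show ?thesis .
      qed
      then show ?thesis
        unfolding N_def[of "A u"] sum_distrib_right by (intro sum_mono) simp
    qed
    then show ?thesis by blast
  qed
  then obtain K0 where K0: "N (A u) \<le> K0 * N u" for u by blast
  \<comment> \<open>The bound is enlarged so that \<open>K\<close> is positive and
    \<open>1 - \<epsilon>\<^sup>2 / K\<close> lies between 0 and 1.\<close>
  define K where "K = max K0 (\<epsilon>\<^sup>2 + 1)"
  have K: "N (A u) \<le> K * N u" for u
    by (rule order.trans[OF K0]) (simp add: K_def N0 mult_right_mono)
  have Kpos: "K > 0" "K \<ge> \<epsilon>\<^sup>2"
    using zero_le_power2[of \<epsilon>] unfolding K_def by linarith+
  define \<rho> where "\<rho> = \<epsilon> / K"
  define q where "q = 1 - \<epsilon>\<^sup>2 / K"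
  have q: "0 \<le> q" "q < 1"
    using Kpos \<epsilon> by (simp_all add: q_def)
  have sf: "Re (sform I M u u) = (\<Sum>k\<in>I. Re (cinner (u k) (A u k)))" for u
    by (simp add: sform_def A_def cinner_sum_right)
  \<comment> \<open>\<open>\<rho> = \<epsilon> / K\<close> minimises the contraction factor \<open>1 - 2\<rho>\<epsilon> + \<rho>\<^sup>2K\<close> of \<open>1 - \<rho>A\<close>.\<close>
  have contr: "N (\<lambda>k. u k - \<rho> *\<^sub>R A u k) \<le> q * N u" for u
  proof -
    have "N (\<lambda>k. u k - \<rho> *\<^sub>R A u k) = N u - 2 * \<rho> * Re (sform I M u u) + \<rho>\<^sup>2 * N (A u)"
      by (simp add: N_def norm_diff_scaleR_sq sf sum.distrib sum_subtractf sum_distrib_left)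
    also have "\<dots> \<le> N u - 2 * \<rho> * (\<epsilon> * N u) + \<rho>\<^sup>2 * (K * N u)"
      using low[of u] K[of u] \<epsilon> Kpos
      by (intro add_mono diff_mono mult_left_mono) (simp_all add: \<rho>_def N_def)
    also have "\<dots> = q * N u"
      using Kpos by (simp add: \<rho>_def q_def power2_eq_square field_simps)
    finally show ?thesis .
  qed
  define U where "U m = ((\<lambda>u k. u k - \<rho> *\<^sub>R (A u k - f k)) ^^ m) (\<lambda>_. 0)" for m
  define d where "d m k = U (Suc m) k - U m k" for m k
  have U_Suc: "U (Suc m) k = U m k - \<rho> *\<^sub>R (A (U m) k - f k)" for m k
    by (simp add: U_def)
  have A_diff: "A (\<lambda>k. u k - v k) k = A u k - A v k" for u v k
    by (simp add: A_def bop_apply_diff sum_subtractf)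
  \<comment> \<open>The inhomogeneity \<open>f\<close> cancels in the increments, so
    \<open>contr\<close> applies to them.\<close>
  have d_Suc: "d (Suc m) = (\<lambda>k. d m k - \<rho> *\<^sub>R A (d m) k)" for m
    by (rule ext, unfold d_def A_diff, simp add: U_Suc algebra_simps)
  have Nd: "N (d m) \<le> q ^ m * N (d 0)" for m
  proof (induction m)
    case (Suc m)
    have "N (d (Suc m)) \<le> q * N (d m)"
      unfolding d_Suc by (rule contr)
    also have "\<dots> \<le> q * (q ^ m * N (d 0))"
      using Suc q by (intro mult_left_mono)
    finally show ?case by simp
  qed simp
  \<comment> \<open>\<open>q\<close> contracts squared norms, hence the square root. The geometric
    bound makes the telescoping series of increments converge.\<close>
  have nd: "norm (d m k) \<le> sqrt (N (d 0)) * sqrt q ^ m" if "k \<in> I" for k m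
  proof -
    have "(norm (d m k))\<^sup>2 \<le> N (d m)"
      unfolding N_def using fin that by (intro member_le_sum) auto
    then have "(norm (d m k))\<^sup>2 \<le> q ^ m * N (d 0)"
      using Nd[of m] by linarith
    then have "norm (d m k) \<le> sqrt (q ^ m * N (d 0))"
      by (rule real_le_rsqrt)
    then show ?thesis
      by (simp add: real_sqrt_mult real_sqrt_power mult.commute)
  qed
  have "convergent (\<lambda>m. U m k)" if "k \<in> I" for k
  proof -
    have "summable (\<lambda>m. sqrt (N (d 0)) * sqrt q ^ m)"
      using q by (intro summable_mult summable_geometric) simp
    then have "summable (\<lambda>m. d m k)"
      by (rule summable_comparison_test') (rule nd[OF that])
    then have "convergent (\<lambda>m. \<Sum>i<m. d i k)"
      by (simp add: summable_iff_convergent)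
    moreover have "(\<Sum>i<m. d i k) = U m k - U 0 k" for m
      unfolding d_def by (rule sum_lessThan_telescope)
    ultimately show ?thesis
      by (simp add: U_def)
  qed
  then obtain u where u: "(\<lambda>m. U m k) \<longlonglongrightarrow> u k" if "k \<in> I" for k
    unfolding convergent_def by metis
  have "A u k = f k" if "k \<in> I" for k
  proof -
    have "(\<lambda>m. A (U m) k) \<longlonglongrightarrow> A u k"
      unfolding A_def
      by (intro tendsto_sum bounded_linear.tendsto[OF bounded_linear_bop_apply] u)
    then have "(\<lambda>m. U (Suc m) k) \<longlonglongrightarrow> u k - \<rho> *\<^sub>R (A u k - f k)"
      unfolding U_Suc by (intro tendsto_intros u that)
    moreover have "(\<lambda>m. U (Suc m) k) \<longlonglongrightarrow> u k"
      using u[OF that] by (rule LIMSEQ_Suc)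
    ultimately have "u k - \<rho> *\<^sub>R (A u k - f k) = u k"
      by (rule LIMSEQ_unique)
    then show ?thesis
      using \<epsilon> Kpos by (simp add: \<rho>_def)
  qed
  then show ?thesis
    unfolding A_def by blast
qed

text \<open>\<open>p\<close> is the inverse of the block of \<open>M\<close> on \<open>I\<close>
  applied to the column \<open>D\<close>. Coercivity makes solutions unique on \<open>I\<close>,
  hence linear in \<open>x\<close>; an energy estimate makes them bounded.\<close>

lemma positive_definite_solution_operators:
  fixes M :: "'i \<Rightarrow> 'i \<Rightarrow> 'h::complex_hilbert_space bop"
  assumes fin: "finite I" and \<epsilon>: "\<epsilon> > 0"
    and low: "\<And>u. \<epsilon> * (\<Sum>k\<in>I. (norm (u k))\<^sup>2) \<le> Re (sform I M u u)"
  obtains p :: "'i \<Rightarrow> 'h bop"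
  where "\<And>k x. k \<in> I \<Longrightarrow> (\<Sum>j\<in>I. bop_apply (M k j) (bop_apply (p j) x)) = bop_apply (D k) x"
proof -
  define A where "A u k = (\<Sum>j\<in>I. bop_apply (M k j) (u j))" for u k
  have sf: "sform I M u u = (\<Sum>k\<in>I. cinner (u k) (A u k))" for u
    by (simp add: sform_def A_def cinner_sum_right)
  have "\<forall>x. \<exists>u. \<forall>k\<in>I. A u k = bop_apply (D k) x"
    
    unfolding A_def by (intro allI positive_definite_solution[OF assms])
  then obtain P where P: "A (P x) k = bop_apply (D k) x" if "k \<in> I" for k x
    by metis
  have uniq: "u k = 0" if "\<And>k. k \<in> I \<Longrightarrow> A u k = 0" "k \<in> I" for u k
  proof -
    have "sform I M u u = 0"
      unfolding sf by (rule sum.neutral) (simp add: that)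
    then have "\<epsilon> * (\<Sum>k\<in>I. (norm (u k))\<^sup>2) \<le> 0"
      using low[of u] by simp
    then have "(\<Sum>k\<in>I. (norm (u k))\<^sup>2) = 0"
      using \<epsilon> by (intro antisym sum_nonneg) (simp_all add: mult_le_0_iff)
    then show ?thesis
      using fin that(2) by (simp add: sum_nonneg_eq_0_iff)
  qed
  have add: "P (x + y) k = P x k + P y k" if "k \<in> I" for x y k
  proof -
    have "A (\<lambda>k. P (x + y) k - P x k - P y k) k = 0" if "k \<in> I" for k
    proof -
      have "A (\<lambda>k. P (x + y) k - P x k - P y k) k = A (P (x + y)) k - A (P x) k - A (P y) k"
        by (simp add: A_def bop_apply_diff sum_subtractf)
      then show ?thesis
        using that by (simp add: P bop_apply_add)
    qed
    from uniq[OF this \<open>k \<in> I\<close>] show ?thesis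
      by (simp add: algebra_simps)
  qed
  have scale: "P (c *\<^sub>C x) k = c *\<^sub>C P x k" if "k \<in> I" for c x k
  proof -
    have "A (\<lambda>k. P (c *\<^sub>C x) k - c *\<^sub>C P x k) k = 0" if "k \<in> I" for k
    proof -
      have "A (\<lambda>k. P (c *\<^sub>C x) k - c *\<^sub>C P x k) k = A (P (c *\<^sub>C x)) k - c *\<^sub>C A (P x) k"
        by (simp add: A_def bop_apply_diff bop_apply_scaleC sum_subtractf
            complex_hilbert.scale_sum_right)
      then show ?thesis
        using that by (simp add: P bop_apply_scaleC)
    qed
    from uniq[OF this \<open>k \<in> I\<close>] show ?thesis
      by simp
  qed
  have "\<exists>B. \<forall>x. norm (P x k) \<le> norm x * B" if "k \<in> I" for k
  proof -
    obtain B where B: "B k \<ge> 0" "norm (bop_apply (D k) x) \<le> norm x * B k" for k x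
    proof -
      have "\<exists>K\<ge>0. \<forall>x. norm (bop_apply (D k) x) \<le> norm x * K" for k
        using bounded_linear.nonneg_bounded[OF bounded_linear_bop_apply] by blast
      then show ?thesis
        using that by metis
    qed
    \<comment> \<open>The weight \<open>\<epsilon>\<close> is chosen so that, after summation, the
      first term is absorbed by half of the coercive lower bound
      \<open>2 * (\<epsilon> * N)\<close>.\<close>
    have young: "2 * Re (cinner u v) \<le> \<epsilon> * (norm u)\<^sup>2 + (norm v)\<^sup>2 / \<epsilon>" for u v :: 'h
    proof -
      have "0 \<le> \<epsilon> * (norm (u - (1 / \<epsilon>) *\<^sub>R v))\<^sup>2"
        using \<epsilon> by simp
      also have "\<dots> = \<epsilon> * (norm u)\<^sup>2 - 2 * Re (cinner u v) + (norm v)\<^sup>2 / \<epsilon>"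
        using \<epsilon> by (simp add: norm_diff_scaleR_sq power_divide field_simps)
          (simp add: power2_eq_square)
      finally show ?thesis by simp
    qed
    have "norm (P x k) \<le> norm x * sqrt ((\<Sum>k\<in>I. (B k)\<^sup>2) / \<epsilon>\<^sup>2)" for x
    proof -
      define N where "N = (\<Sum>k\<in>I. (norm (P x k))\<^sup>2)"
      have "2 * (\<epsilon> * N) \<le> (\<Sum>k\<in>I. 2 * Re (cinner (P x k) (bop_apply (D k) x)))"
        using low[of "P x"] by (simp add: N_def sf P flip: sum_distrib_left)
      also have "\<dots> \<le> (\<Sum>k\<in>I. \<epsilon> * (norm (P x k))\<^sup>2 + (norm (bop_apply (D k) x))\<^sup>2 / \<epsilon>)"
        by (intro sum_mono young)
      also have "\<dots> \<le> (\<Sum>k\<in>I. \<epsilon> * (norm (P x k))\<^sup>2 + (norm x * B k)\<^sup>2 / \<epsilon>)"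
        using \<epsilon> B by (intro sum_mono add_left_mono divide_right_mono power_mono) auto
      also have "\<dots> = \<epsilon> * N + (norm x)\<^sup>2 * (\<Sum>k\<in>I. (B k)\<^sup>2) / \<epsilon>"
        by (simp add: N_def sum.distrib sum_distrib_left sum_divide_distrib power_mult_distrib)
      finally have "N \<le> (norm x)\<^sup>2 * ((\<Sum>k\<in>I. (B k)\<^sup>2) / \<epsilon>\<^sup>2)"
        using \<epsilon> by (simp add: field_simps power2_eq_square)
      moreover have "(norm (P x k))\<^sup>2 \<le> N"
        unfolding N_def using fin that by (intro member_le_sum) auto
      ultimately have "norm (P x k) \<le> sqrt ((norm x)\<^sup>2 * ((\<Sum>k\<in>I. (B k)\<^sup>2) / \<epsilon>\<^sup>2))"
        by (intro real_le_rsqrt) linarith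
      then show ?thesis
        by (simp only: real_sqrt_mult real_sqrt_abs abs_norm_cancel)
    qed
    then show ?thesis by blast
  qed
  then obtain B where B: "norm (P x k) \<le> norm x * B k" if "k \<in> I" for k x
    by metis
  have "bounded_linear (\<lambda>x. P x k)" if "k \<in> I" for k
    using add[OF that] scale[OF that, of "complex_of_real _", unfolded scaleC_of_real] B[OF that]
    by (rule bounded_linear_intro)
  then have "bop_apply (Bop (\<lambda>x. P x k)) x = P x k" if "k \<in> I" for k x
    using that scale by (simp add: bop_apply_Bop)
  then show ?thesis
    using P by (intro that[of "\<lambda>k. Bop (\<lambda>x. P x k)"]) (simp add: A_def)
qed

text \<open>With \<open>X\<close> equal to row \<open>a\<close> times the inverse middle block times
  column \<open>b\<close>, and \<open>Y\<close> likewise with \<open>a\<close> and \<open>b\<close>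
  exchanged, the Schur complement of the middle block is diagonal. Its two entries are the Schur
  complements of the given bordered blocks, which are positive.\<close>

lemma positive_completion:
  fixes M :: "'i \<Rightarrow> 'i \<Rightarrow> 'h::complex_hilbert_space bop"
  assumes fin: "finite I" and ab: "a \<noteq> b" "a \<notin> I" "b \<notin> I" and \<epsilon>: "\<epsilon> > 0"
    and low: "\<And>u. \<epsilon> * (\<Sum>k\<in>I. (norm (u k))\<^sup>2) \<le> Re (sform I M u u)"
    and pos: "positive_on (insert a I) M" "positive_on (insert b I) M"
  obtains X Y where
    "\<And>M'. (\<And>k j. (k, j) \<noteq> (a, b) \<Longrightarrow> (k, j) \<noteq> (b, a) \<Longrightarrow> M' k j = M k j) \<Longrightarrow>
      M' a b = X \<Longrightarrow> M' b a = Y \<Longrightarrow> positive_on (insert a (insert b I)) M'"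
proof -
  obtain p where p: "(\<Sum>j\<in>I. bop_apply (M k j) (bop_apply (p j) x)) = bop_apply (M k a) x"
    if "k \<in> I" for k x
    using positive_definite_solution_operators[OF fin \<epsilon> low, where D = "\<lambda>k. M k a"] by metis
  obtain q where q: "(\<Sum>j\<in>I. bop_apply (M k j) (bop_apply (q j) x)) = bop_apply (M k b) x"
    if "k \<in> I" for k x
    using positive_definite_solution_operators[OF fin \<epsilon> low, where D = "\<lambda>k. M k b"] by metis
  have comp: "\<exists>X. \<forall>y. bop_apply X y = (\<Sum>j\<in>I. bop_apply (A j) (bop_apply (B j) y))"
    for A B :: "'i \<Rightarrow> 'h bop"
  proof -
    have "bop_apply (Bop (\<lambda>y. \<Sum>j\<in>I. bop_apply (A j) (bop_apply (B j) y)))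
        = (\<lambda>y. \<Sum>j\<in>I. bop_apply (A j) (bop_apply (B j) y))"
      by (rule bop_apply_Bop)
        (auto intro!: bounded_linear_sum bounded_linear_compose[OF bounded_linear_bop_apply]
          bounded_linear_bop_apply simp: bop_apply_scaleC complex_hilbert.scale_sum_right)
    then show ?thesis by metis
  qed
  obtain X where X: "bop_apply X y = (\<Sum>j\<in>I. bop_apply (M a j) (bop_apply (q j) y))" for y
    using comp by blast
  obtain Y where Y: "bop_apply Y x = (\<Sum>j\<in>I. bop_apply (M b j) (bop_apply (p j) x))" for x
    using comp by blast
  have "positive_on (insert a (insert b I)) M'"
    if M': "\<And>k j. (k, j) \<noteq> (a, b) \<Longrightarrow> (k, j) \<noteq> (b, a) \<Longrightarrow> M' k j = M k j"
      "M' a b = X" "M' b a = Y" for M' :: "'i \<Rightarrow> 'i \<Rightarrow> 'h bop"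
    unfolding positive_on_def
  proof
    fix u :: "'i \<Rightarrow> 'h"
    define x y where "x = u a" and "y = u b"
    define P Q where "P k = bop_apply (p k) x" and "Q k = bop_apply (q k) y" for k
    have ne: "k \<noteq> a" "k \<noteq> b" if "k \<in> I" for k
      using that ab by auto
    \<comment> \<open>\<open>P\<close> solves the middle block for column \<open>a\<close> at
      \<open>x\<close>, so pairing with \<open>P\<close> reproduces that column. Hermitian symmetry
      then yields the row version \<open>from_a\<close>; \<open>Q\<close> does the same for
      \<open>b\<close>.\<close>
    have to_a: "sform I M v P = (\<Sum>k\<in>I. cinner (v k) (bop_apply (M k a) x))" for v
      by (simp add: sform_def P_def p flip: cinner_sum_right)
    have to_b: "sform I M v Q = (\<Sum>k\<in>I. cinner (v k) (bop_apply (M k b) y))" for v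
      by (simp add: sform_def Q_def q flip: cinner_sum_right)
    have posI: "positive_on I M"
      by (rule positive_on_subset[OF pos(1)]) (use fin in auto)
    have from_a: "sform I M P v = (\<Sum>j\<in>I. cinner x (bop_apply (M a j) (v j)))" for v
      unfolding positive_on_row_column[OF fin ab(2) pos(1)] to_a[symmetric]
      by (rule sform_hermitian[OF posI])
    have from_b: "sform I M Q v = (\<Sum>j\<in>I. cinner y (bop_apply (M b j) (v j)))" for v
      unfolding positive_on_row_column[OF fin ab(3) pos(2)] to_b[symmetric]
      by (rule sform_hermitian[OF posI])
    \<comment> \<open>The shift of \<open>u\<close> that absorbs the cross terms between
      \<open>I\<close> and the indices \<open>a\<close>, \<open>b\<close>.\<close>
    define w where "w k = u k + (P k + Q k)" for k
    \<comment> \<open>Positivity of a Schur complement: the bordered form is evaluated at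
      \<open>z\<close> in place \<open>c\<close> and \<open>- R\<close> on \<open>I\<close>. Each of
      the two cross terms equals \<open>- sform I M R R\<close>, and the block on \<open>I\<close>
      gives one such term back.\<close>
    have "cinner z (bop_apply (M c c) z) - sform I M R R \<in> \<real>\<^sub>\<ge>\<^sub>0"
      if c: "c \<notin> I" "positive_on (insert c I) M"
        and to: "\<And>v. sform I M v R = (\<Sum>k\<in>I. cinner (v k) (bop_apply (M k c) z))"
        and "from": "\<And>v. sform I M R v = (\<Sum>j\<in>I. cinner z (bop_apply (M c j) (v j)))" for c z R
    proof -
      let ?R = "(\<lambda>k. - R k)(c := z)"
      have ne: "?R k = - R k" if "k \<in> I" for k
        using that c by auto
      have "sform I M ?R ?R = sform I M (\<lambda>k. - R k) (\<lambda>k. - R k)"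
        by (rule sform_cong) (simp_all add: ne del: fun_upd_apply)
      moreover have "(\<Sum>j\<in>I. cinner z (bop_apply (M c j) (?R j))) = - sform I M R R"
        by (simp add: ne "from" bop_apply_minus cinner_minus_right sum_negf
            del: fun_upd_apply cong: sum.cong)
      moreover have "(\<Sum>k\<in>I. cinner (?R k) (bop_apply (M k c) z)) = - sform I M R R"
        by (simp add: ne to cinner_minus_left sum_negf del: fun_upd_apply cong: sum.cong)
      ultimately have "sform (insert c I) M ?R ?R = cinner z (bop_apply (M c c) z) - sform I M R R"
        using fin c by (simp add: sform_insert sform_minus_left sform_minus_right)
      then show ?thesis
        using c(2) by (metis positive_on_def)
    qed
    note pos_a = this[OF ab(2) pos(1) to_a from_a] and pos_b = this[OF ab(3) pos(2) to_b from_b]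
    have pos_w: "sform I M w w \<in> \<real>\<^sub>\<ge>\<^sub>0"
      using posI by (simp add: positive_on_def)
    have Mu: "sform I M' u u = sform I M u u"
      using ne by (intro sform_cong) (auto intro!: M'(1))
    have rows: "M' a k = M a k" "M' k a = M k a" "M' b k = M b k" "M' k b = M k b" if "k \<in> I" for k
      using ab ne[OF that] by (auto intro!: M'(1))
    have diag: "M' a a = M a a" "M' b b = M b b"
      using ab by (auto intro!: M'(1))
    \<comment> \<open>Completing the square in the middle block leaves the two Schur complements.\<close>
    have "sform (insert a (insert b I)) M' u u
        = (cinner x (bop_apply (M a a) x) - sform I M P P)
          + (cinner y (bop_apply (M b b) y) - sform I M Q Q) + sform I M w w"
    proof -
      \<comment> \<open>The choice of the corners enters here: they are exactly the mixed terms that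
        the square produces.\<close>
      have "sform I M P Q = cinner x (bop_apply X y)" "sform I M Q P = cinner y (bop_apply Y x)"
        by (simp_all add: from_a from_b X Y cinner_sum_right P_def Q_def)
      then have "sform I M w w = sform I M u u + sform I M u P + sform I M u Q
          + sform I M P u + sform I M P P + cinner x (bop_apply X y)
          + sform I M Q u + cinner y (bop_apply Y x) + sform I M Q Q"
        unfolding w_def by (simp add: sform_add_left sform_add_right)
      then show ?thesis
        using fin ab
        by (simp add: sform_insert M' diag rows Mu from_a from_b to_a to_b x_def[symmetric]
            y_def[symmetric] cong: sum.cong)
    qed
    then show "sform (insert a (insert b I)) M' u u \<in> \<real>\<^sub>\<ge>\<^sub>0"
      using pos_a pos_b pos_w by (simp only: nonneg_Reals_add_I)
  qed
  then show ?thesis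
    by (rule that)
qed

section \<open>Extending positive Toeplitz matrices\<close>

definition id_bop :: "'h::complex_hilbert_space bop" where
  "id_bop = Bop (\<lambda>x. x)"

lemma bop_apply_id: "bop_apply id_bop x = x"
  by (simp add: id_bop_def bop_apply_Bop bounded_linear_ident)

text \<open>Index difference 0 is exactly the diagonal, so perturbing \<open>\<tau> 0\<close>
  perturbs the whole matrix by a multiple of the identity. This supplies the coercivity that the
  completion requires.\<close>

lemma toeplitz_add_scalar:
  fixes \<tau> :: "int \<Rightarrow> 'h::complex_hilbert_space bop"
  assumes "finite I"
  shows "sform I (toeplitz_matrix (\<tau>(0 := \<tau> 0 + scaleC_bop (complex_of_real \<delta>) id_bop))) u u
    = sform I (toeplitz_matrix \<tau>) u u + complex_of_real (\<delta> * (\<Sum>k\<in>I. (norm (u k))\<^sup>2))"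
proof -
  let ?\<sigma> = "\<tau>(0 := \<tau> 0 + scaleC_bop (complex_of_real \<delta>) id_bop)"
  have "cinner (u k) (bop_apply (toeplitz_matrix ?\<sigma> k j) (u j))
      = cinner (u k) (bop_apply (toeplitz_matrix \<tau> k j) (u j))
        + (if j = k then complex_of_real (\<delta> * (norm (u k))\<^sup>2) else 0)" for k j
    by (simp add: toeplitz_matrix_def plus_bop.rep_eq scaleC_bop.rep_eq bop_apply_id
        cinner_add_right cinner_scaleC_right cinner_self)
  then show ?thesis
    using assms by (simp add: sform_def sum.distrib sum_distrib_left)
qed

lemma positive_toeplitz_add_scalar:
  fixes \<tau> :: "int \<Rightarrow> 'h::complex_hilbert_space bop"
  assumes "finite I" "\<delta> \<ge> 0" "positive_on I (toeplitz_matrix \<tau>)"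
  shows "positive_on I (toeplitz_matrix (\<tau>(0 := \<tau> 0 + scaleC_bop (complex_of_real \<delta>) id_bop)))"
  unfolding positive_on_def toeplitz_add_scalar[OF assms(1)]
proof
  fix u :: "nat \<Rightarrow> 'h"
  have "0 \<le> \<delta> * (\<Sum>k\<in>I. (norm (u k))\<^sup>2)"
    using assms(2) by (simp add: sum_nonneg)
  then have "complex_of_real (\<delta> * (\<Sum>k\<in>I. (norm (u k))\<^sup>2)) \<in> \<real>\<^sub>\<ge>\<^sub>0"
    by (simp only: nonneg_Reals_of_real_iff)
  then show "sform I (toeplitz_matrix \<tau>) u u + complex_of_real (\<delta> * (\<Sum>k\<in>I. (norm (u k))\<^sup>2)) \<in> \<real>\<^sub>\<ge>\<^sub>0"
    using assms(3) by (intro nonneg_Reals_add_I) (simp_all add: positive_on_def)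
qed

text \<open>Dropping the last or the first index of the larger matrix leaves two copies of the same
  Toeplitz matrix, overlapping in the middle block. Only the two corners are unspecified, so any
  completion is again Toeplitz.\<close>

lemma toeplitz_extend_one:
  fixes \<tau> :: "int \<Rightarrow> 'h::complex_hilbert_space bop"
  assumes n: "n \<ge> 1" and \<delta>: "\<delta> > 0" and pos: "positive_on {1..n} (toeplitz_matrix \<tau>)"
  obtains \<tau>' where "\<And>d. d \<noteq> 0 \<Longrightarrow> \<bar>d\<bar> < int n \<Longrightarrow> \<tau>' d = \<tau> d"
    "\<tau>' 0 = \<tau> 0 + scaleC_bop (complex_of_real \<delta>) id_bop"
    "positive_on {1..Suc n} (toeplitz_matrix \<tau>')"
proof -
  define \<sigma> where "\<sigma> = \<tau>(0 := \<tau> 0 + scaleC_bop (complex_of_real \<delta>) id_bop)"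
  \<comment> \<open>The overlap of the index ranges \<open>{1..n}\<close> and
    \<open>{2..Suc n}\<close>; it is empty for \<open>n = 1\<close>.\<close>
  define I where "I = {2..n}"
  have I: "finite I" "Suc n \<noteq> 1" "Suc n \<notin> I" "1 \<notin> I"
    using n by (auto simp: I_def)
  have ins: "insert 1 I = {1..n}" "insert (Suc n) I = {Suc 1..Suc n}"
    "insert (Suc n) (insert 1 I) = {1..Suc n}"
    using n by (auto simp: I_def)
  have pos1: "positive_on (insert 1 I) (toeplitz_matrix \<sigma>)"
    unfolding ins \<sigma>_def using \<delta> pos by (intro positive_toeplitz_add_scalar) auto
  \<comment> \<open>Entries depend only on \<open>k - j\<close>, so shifting both indices by one
    changes nothing.\<close>
  have "sform {Suc 1..Suc n} (toeplitz_matrix \<sigma>) u u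
      = sform {1..n} (toeplitz_matrix \<sigma>) (\<lambda>k. u (Suc k)) (\<lambda>k. u (Suc k))" for u
    by (simp only: sform_def sum.shift_bounds_cl_Suc_ivl) (simp add: toeplitz_matrix_def)
  then have pos2: "positive_on (insert (Suc n) I) (toeplitz_matrix \<sigma>)"
    using pos1 unfolding ins by (simp add: positive_on_def)
  have "positive_on I (toeplitz_matrix \<tau>)"
    by (rule positive_on_subset[OF pos]) (auto simp: I_def)
  then have low: "\<delta> * (\<Sum>k\<in>I. (norm (u k))\<^sup>2) \<le> Re (sform I (toeplitz_matrix \<sigma>) u u)" for u
    using I(1) unfolding \<sigma>_def toeplitz_add_scalar[OF I(1)]
    by (simp add: positive_on_def complex_nonneg_Reals_iff)
  obtain X Y where XY: "\<And>M'. (\<And>k j. (k, j) \<noteq> (Suc n, 1) \<Longrightarrow> (k, j) \<noteq> (1, Suc n) \<Longrightarrow>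
        M' k j = toeplitz_matrix \<sigma> k j) \<Longrightarrow> M' (Suc n) 1 = X \<Longrightarrow> M' 1 (Suc n) = Y \<Longrightarrow>
      positive_on (insert (Suc n) (insert 1 I)) M'"
    using positive_completion[OF I \<delta> low pos2 pos1] by metis
  \<comment> \<open>In size \<open>Suc n\<close> the difference \<open>n\<close> occurs only at
    \<open>(Suc n, 1)\<close> and \<open>- n\<close> only at \<open>(1, Suc n)\<close>, so these two
    updates set just the corners.\<close>
  define \<tau>' where "\<tau>' = \<sigma>(int n := X, - int n := Y)"
  let ?M = "\<lambda>k j. if (k, j) = (Suc n, 1) then X else if (k, j) = (1, Suc n) then Y
    else toeplitz_matrix \<sigma> k j"
  have "positive_on {1..Suc n} ?M"
    unfolding ins[symmetric] by (rule XY) (use n in auto)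
  moreover have "sform {1..Suc n} ?M u u = sform {1..Suc n} (toeplitz_matrix \<tau>') u u" for u
  proof (rule sform_cong)
    fix k j
    assume "k \<in> {1..Suc n}" "j \<in> {1..Suc n}"
    then have "int k - int j = int n \<longleftrightarrow> k = Suc n \<and> j = 1"
      "int k - int j = - int n \<longleftrightarrow> k = 1 \<and> j = Suc n"
      by auto
    then show "?M k j = toeplitz_matrix \<tau>' k j"
      using n by (auto simp: toeplitz_matrix_def \<tau>'_def)
  qed simp_all
  ultimately have "positive_on {1..Suc n} (toeplitz_matrix \<tau>')"
    by (simp add: positive_on_def)
  moreover have "\<tau>' d = \<tau> d" if "d \<noteq> 0" "\<bar>d\<bar> < int n" for d
    using that by (auto simp: \<tau>'_def \<sigma>_def)
  moreover have "\<tau>' 0 = \<tau> 0 + scaleC_bop (complex_of_real \<delta>) id_bop"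
    using n by (simp add: \<tau>'_def \<sigma>_def)
  ultimately show ?thesis
    by (intro that)
qed

text \<open>The total perturbation is \<open>\<delta>\<close> whatever \<open>N\<close> is: with
  \<open>\<delta>\<close> generalised in the induction, one half is spent on reaching size
  \<open>N\<close> and the other half on the last extension.\<close>

lemma toeplitz_extend:
  fixes \<tau> :: "int \<Rightarrow> 'h::complex_hilbert_space bop"
  assumes "n \<ge> 1" "\<delta> > 0" "positive_on {1..n} (toeplitz_matrix \<tau>)" "n \<le> N"
  shows "\<exists>\<sigma>. (\<forall>d. d \<noteq> 0 \<longrightarrow> \<bar>d\<bar> < int n \<longrightarrow> \<sigma> d = \<tau> d) \<and>
    \<sigma> 0 = \<tau> 0 + scaleC_bop (complex_of_real \<delta>) id_bop \<and>
    positive_on {1..N} (toeplitz_matrix \<sigma>)"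
  using \<open>n \<le> N\<close> \<open>\<delta> > 0\<close>
proof (induction N arbitrary: \<delta> rule: dec_induct)
  case base
  define \<sigma> where "\<sigma> = \<tau>(0 := \<tau> 0 + scaleC_bop (complex_of_real \<delta>) id_bop)"
  have "positive_on {1..n} (toeplitz_matrix \<sigma>)"
    unfolding \<sigma>_def using base assms(3) by (intro positive_toeplitz_add_scalar) auto
  moreover have "\<sigma> 0 = \<tau> 0 + scaleC_bop (complex_of_real \<delta>) id_bop" "\<And>d. d \<noteq> 0 \<Longrightarrow> \<sigma> d = \<tau> d"
    by (simp_all add: \<sigma>_def)
  ultimately show ?case
    by blast
next
  case (step N)
  obtain \<sigma> where \<sigma>: "\<And>d. d \<noteq> 0 \<Longrightarrow> \<bar>d\<bar> < int n \<Longrightarrow> \<sigma> d = \<tau> d"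
    "\<sigma> 0 = \<tau> 0 + scaleC_bop (complex_of_real (\<delta> / 2)) id_bop"
    "positive_on {1..N} (toeplitz_matrix \<sigma>)"
    using step.IH[of "\<delta> / 2"] step.prems by (metis half_gt_zero)
  obtain \<sigma>' where \<sigma>': "\<And>d. d \<noteq> 0 \<Longrightarrow> \<bar>d\<bar> < int N \<Longrightarrow> \<sigma>' d = \<sigma> d"
    "\<sigma>' 0 = \<sigma> 0 + scaleC_bop (complex_of_real (\<delta> / 2)) id_bop"
    "positive_on {1..Suc N} (toeplitz_matrix \<sigma>')"
  proof (rule toeplitz_extend_one)
    show "1 \<le> N"
      using step.hyps(1) assms(1) by simp
    show "0 < \<delta> / 2"
      using step.prems by simp
  qed (rule \<sigma>(3), rule that)
  have half: "scaleC_bop (complex_of_real (\<delta> / 2)) id_bop + scaleC_bop (complex_of_real (\<delta> / 2)) id_bop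
      = (scaleC_bop (complex_of_real \<delta>) id_bop :: 'h bop)"
    by (simp only: vector_space.vector_space_assms(2)[OF vector_space_bop, symmetric]
        flip: of_real_add) simp
  have "\<sigma>' d = \<tau> d" if "d \<noteq> 0" "\<bar>d\<bar> < int n" for d
    using that step.hyps \<sigma>(1) \<sigma>'(1) by simp
  moreover have "\<sigma>' 0 = \<tau> 0 + scaleC_bop (complex_of_real \<delta>) id_bop"
    by (simp only: \<sigma>'(2) \<sigma>(2) add.assoc half)
  ultimately show ?case
    using \<sigma>'(3) by blast
qed

section \<open>Fejer averaging over roots of unity\<close>

text \<open>A geometric sum over the powers of a root of unity of order dividing \<open>L\<close>.
  The bound on \<open>d\<close> excludes nonzero multiples of \<open>L\<close>, so the root is
  nontrivial unless \<open>d = 0\<close>.\<close>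

lemma sum_roots_of_unity:
  assumes "\<bar>d\<bar> < int L"
  shows "(\<Sum>l<L. cis (2 * pi * real l * real_of_int d / real L)) = (if d = 0 then of_nat L else 0)"
proof (cases "d = 0")
  case False
  define z where "z = cis (2 * pi * real_of_int d / real L)"
  have L: "L > 0"
    using assms by simp
  have "z ^ L = 1"
    using L by (simp add: z_def Complex.DeMoivre)
  moreover have "z \<noteq> 1"
  proof
    assume "z = 1"
    then obtain m :: int where "2 * pi * real_of_int d / real L = of_int m * (2 * pi)"
      by (auto simp: z_def complex_eq_iff cos_one_2pi_int mult.commute)
    then have "real_of_int d = real_of_int (m * int L)"
      using L by (simp add: field_simps)
    then have "d = m * int L"
      by (simp only: of_int_eq_iff)
    with assms False show False
      by (auto simp: abs_mult)
  qed
  ultimately have "(\<Sum>l<L. z ^ l) = 0"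
    by (simp add: geometric_sum)
  then show ?thesis
    using False by (simp add: z_def Complex.DeMoivre mult_ac)
qed simp

text \<open>Each \<open>a\<close> admits at most the one partner \<open>b = a - d\<close>, which is
  in range for \<open>1 + d \<le> a \<le> N + d\<close>. The resulting length of the diagonal is the
  Fejer weight.\<close>

lemma count_differences:
  assumes "\<bar>d\<bar> \<le> int N"
  shows "(\<Sum>a=1..N. \<Sum>b=1..N. if int a - int b = d then c else 0) = of_int (int N - \<bar>d\<bar>) * (c::complex)"
proof -
  have "(\<Sum>b=1..N. if int a - int b = d then c else 0)
      = (if a \<in> {nat (1 + d)..nat (int N + d)} then c else 0)" if "a \<in> {1..N}" for a
  proof -
    have "(\<Sum>b=1..N. if int a - int b = d then c else 0)
        = (\<Sum>b=1..N. if b = nat (int a - d) then if int a \<ge> d then c else 0 else 0)"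
      by (intro sum.cong) auto
    then show ?thesis
      using that by (auto simp: sum.delta)
  qed
  then have "(\<Sum>a=1..N. \<Sum>b=1..N. if int a - int b = d then c else 0)
      = (\<Sum>a=1..N. if a \<in> {nat (1 + d)..nat (int N + d)} then c else 0)"
    by (rule sum.cong[OF refl])
  also have "\<dots> = (\<Sum>a\<in>{1..N} \<inter> {nat (1 + d)..nat (int N + d)}. c)"
    by (rule sum.inter_restrict[symmetric]) simp
  also have "{1..N} \<inter> {nat (1 + d)..nat (int N + d)} = {max 1 (nat (1 + d))..min N (nat (int N + d))}"
    by auto
  also have "(\<Sum>a\<in>\<dots>. c) = of_nat (Suc (min N (nat (int N + d))) - max 1 (nat (1 + d))) * c"
    by simp
  also have "Suc (min N (nat (int N + d))) - max 1 (nat (1 + d)) = nat (int N - \<bar>d\<bar>)"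
    using assms by (auto simp: min_def max_def)
  finally show ?thesis
    using assms by simp
qed

text \<open>Each \<open>\<psi> (E l)\<close> is positive. Testing it on a combination of the
  \<open>\<xi> j\<close> with phases and summing over \<open>l\<close> keeps only the entries with
  \<open>a - b = k - j\<close>, and there are \<open>N - \<bar>k - j\<bar>\<close> of them.\<close>

lemma positive_map_fejer_mean:
  fixes \<psi> :: "'h::complex_hilbert_space bop \<Rightarrow> 'k::complex_hilbert_space bop"
  assumes \<psi>: "positive_linear_map \<psi>" and pos: "positive_on {1..N} (toeplitz_matrix \<sigma>)" and "n \<le> N"
  shows "(\<Sum>k=1..n. \<Sum>j=1..n. of_int (int N - \<bar>int k - int j\<bar>) *
    cinner (\<xi> k) (bop_apply (\<psi> (\<sigma> (int k - int j))) (\<xi> j))) \<in> \<real>\<^sub>\<ge>\<^sub>0"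
proof (cases "N = 0")
  case False
  \<comment> \<open>The exponents \<open>(k - j) - (a - b)\<close> have modulus at most
    \<open>2 * N - 2\<close>, so order \<open>2 * N\<close> avoids aliasing.\<close>
  define L where "L = 2 * N"
  define w where "w l d = cis (2 * pi * real l * real_of_int d / real L)" for l and d :: int
  have w_add: "w l (d + e) = w l d * w l e" for l d e
    by (simp add: w_def cis_mult algebra_simps add_divide_distrib)
  have w_cnj: "cnj (w l d) = w l (- d)" for l d
    by (simp add: w_def cis_cnj)
  have \<psi>_sum: "\<psi> (\<Sum>i\<in>S. f i) = (\<Sum>i\<in>S. \<psi> (f i))" and \<psi>_scale: "\<psi> (scaleC_bop c A) = scaleC_bop c (\<psi> A)"
    for S :: "nat set" and f c A
    using \<psi> unfolding positive_linear_map_def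
    by (auto simp: module_hom.sum[OF Vector_Spaces.linear.axioms(3)] module_hom.scale[OF Vector_Spaces.linear.axioms(3)])
  \<comment> \<open>The phase is \<open>cnj (w l a) * w l b\<close>, so the form of
    \<open>E l\<close> at \<open>x\<close> is the Toeplitz form at the tuple of vectors
    \<open>w l a *\<^sub>C x\<close>.\<close>
  define E where "E l = (\<Sum>a=1..N. \<Sum>b=1..N. scaleC_bop (w l (int b - int a)) (\<sigma> (int a - int b)))" for l
  have "positive_bop (E l)" for l
    unfolding positive_bop_def
  proof
    fix x
    have "cinner x (bop_apply (E l) x)
        = sform {1..N} (toeplitz_matrix \<sigma>) (\<lambda>a. w l (int a) *\<^sub>C x) (\<lambda>a. w l (int a) *\<^sub>C x)"
      by (simp add: E_def sform_def toeplitz_matrix_def sum_bop_apply scaleC_bop.rep_eq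
          cinner_sum_right cinner_scaleC_right cinner_scaleC_left bop_apply_scaleC w_cnj
          diff_conv_add_uminus w_add mult_ac del: add_uminus_conv_diff)
    then show "cinner x (bop_apply (E l) x) \<in> \<real>\<^sub>\<ge>\<^sub>0"
      using pos by (simp add: positive_on_def)
  qed
  then have pos\<psi>: "cinner y (bop_apply (\<psi> (E l)) y) \<in> \<real>\<^sub>\<ge>\<^sub>0" for l y
    using \<psi> by (simp add: positive_linear_map_def positive_bop_def)
  define c where "c k j d = cinner (\<xi> k) (bop_apply (\<psi> (\<sigma> d)) (\<xi> j))" for k j d
  \<comment> \<open>The negative exponents give the pair \<open>(k, j)\<close> the phase
    \<open>w l (k - j)\<close>, which cancels that of \<open>E l\<close> for every \<open>l\<close>
    when \<open>a - b = k - j\<close>.\<close>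
  define \<eta> where "\<eta> l = (\<Sum>j=1..n. w l (- int j) *\<^sub>C \<xi> j)" for l
  have "cinner (\<eta> l) (bop_apply (\<psi> (E l)) (\<eta> l)) = (\<Sum>k=1..n. \<Sum>j=1..n. \<Sum>a=1..N. \<Sum>b=1..N.
      w l ((int k - int j) - (int a - int b)) * c k j (int a - int b))" for l
  proof -
    have "cinner (\<eta> l) (bop_apply (\<psi> (E l)) (\<eta> l))
        = (\<Sum>k=1..n. \<Sum>j=1..n. w l (int k) * w l (- int j) * cinner (\<xi> k) (bop_apply (\<psi> (E l)) (\<xi> j)))"
      by (simp add: \<eta>_def cinner_sum_left cinner_sum_right bop_apply_sum bop_apply_scaleC
          cinner_scaleC_left cinner_scaleC_right w_cnj mult_ac sum_distrib_left)
        (rule sum.swap)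
    also have "\<dots> = (\<Sum>k=1..n. \<Sum>j=1..n. \<Sum>a=1..N. \<Sum>b=1..N.
        w l ((int k - int j) - (int a - int b)) * c k j (int a - int b))"
    proof (intro sum.cong refl)
      fix k j
      have "cinner (\<xi> k) (bop_apply (\<psi> (E l)) (\<xi> j))
          = (\<Sum>a=1..N. \<Sum>b=1..N. w l (int b - int a) * c k j (int a - int b))"
        by (simp add: E_def \<psi>_sum \<psi>_scale sum_bop_apply scaleC_bop.rep_eq cinner_sum_right
            cinner_scaleC_right c_def)
      moreover have "w l ((int k - int j) - (int a - int b))
          = w l (int k) * w l (- int j) * w l (int b - int a)" for a b
        by (simp flip: w_add add: algebra_simps)
      ultimately show "w l (int k) * w l (- int j) * cinner (\<xi> k) (bop_apply (\<psi> (E l)) (\<xi> j))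
          = (\<Sum>a=1..N. \<Sum>b=1..N. w l ((int k - int j) - (int a - int b)) * c k j (int a - int b))"
        by (simp add: sum_distrib_left mult.assoc)
    qed
    finally show ?thesis .
  qed
  then have "(\<Sum>l<L. cinner (\<eta> l) (bop_apply (\<psi> (E l)) (\<eta> l)))
      = (\<Sum>l<L. \<Sum>k=1..n. \<Sum>j=1..n. \<Sum>a=1..N. \<Sum>b=1..N.
          w l ((int k - int j) - (int a - int b)) * c k j (int a - int b))"
    by simp
  also have "\<dots> = (\<Sum>k=1..n. \<Sum>j=1..n. \<Sum>a=1..N. \<Sum>b=1..N. \<Sum>l<L.
          w l ((int k - int j) - (int a - int b)) * c k j (int a - int b))"
    by (simp only: sum.swap[of _ _ "{..<L}"])
  also have "\<dots> = (\<Sum>k=1..n. \<Sum>j=1..n. \<Sum>a=1..N. \<Sum>b=1..N.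
      if int a - int b = int k - int j then of_nat L * c k j (int k - int j) else 0)"
  proof (intro sum.cong refl)
    fix k j a b
    assume "k \<in> {1..n}" "j \<in> {1..n}" "a \<in> {1..N}" "b \<in> {1..N}"
    then have "\<bar>(int k - int j) - (int a - int b)\<bar> < int L"
      using \<open>n \<le> N\<close> by (auto simp: L_def)
    from sum_roots_of_unity[OF this]
    show "(\<Sum>l<L. w l ((int k - int j) - (int a - int b)) * c k j (int a - int b))
        = (if int a - int b = int k - int j then of_nat L * c k j (int k - int j) else 0)"
      unfolding w_def by (simp flip: sum_distrib_right)
  qed
  also have "\<dots> = (\<Sum>k=1..n. \<Sum>j=1..n. of_int (int N - \<bar>int k - int j\<bar>) *
      (of_nat L * c k j (int k - int j)))"
    using \<open>n \<le> N\<close> by (intro sum.cong refl count_differences) auto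
  also have "\<dots> = of_nat L * (\<Sum>k=1..n. \<Sum>j=1..n. of_int (int N - \<bar>int k - int j\<bar>) * c k j (int k - int j))"
    by (simp add: sum_distrib_left mult_ac)
  finally have "of_nat L * (\<Sum>k=1..n. \<Sum>j=1..n. of_int (int N - \<bar>int k - int j\<bar>) * c k j (int k - int j))
      = (\<Sum>l<L. cinner (\<eta> l) (bop_apply (\<psi> (E l)) (\<eta> l)))" ..
  moreover have "(\<Sum>l<L. cinner (\<eta> l) (bop_apply (\<psi> (E l)) (\<eta> l))) \<in> \<real>\<^sub>\<ge>\<^sub>0"
    using pos\<psi> by (induction L) (auto intro: nonneg_Reals_add_I)
  moreover have "inverse (of_nat L :: complex) \<in> \<real>\<^sub>\<ge>\<^sub>0"
    by (simp add: nonneg_Reals_inverse_I)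
  ultimately have "inverse (of_nat L) * (of_nat L * (\<Sum>k=1..n. \<Sum>j=1..n.
      of_int (int N - \<bar>int k - int j\<bar>) * c k j (int k - int j))) \<in> \<real>\<^sub>\<ge>\<^sub>0"
    by (metis nonneg_Reals_mult_I)
  moreover have "of_nat L \<noteq> (0::complex)"
    using False by (simp add: L_def)
  ultimately show ?thesis
    by (simp add: c_def flip: mult.assoc)
qed (use assms in simp)

section \<open>The limit of the Fejer means\<close>

theorem theorem5p3:
  fixes \<psi> :: "'h::complex_hilbert_space bop \<Rightarrow> 'k::complex_hilbert_space bop"
  assumes "infinite_dimensional TYPE('h)"
    and "positive_linear_map \<psi>"
    and "normal_map \<psi>"
  shows "toeplitz_completely_positive \<psi>"
  unfolding toeplitz_completely_positive_def positive_opmatrix_iff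
proof (intro allI impI)
  fix n :: nat and \<tau> :: "int \<Rightarrow> 'h bop"
  assume n: "1 \<le> n" and pos: "positive_on {1..n} (toeplitz_matrix \<tau>)"
  have \<psi>_add: "\<psi> (A + B) = \<psi> A + \<psi> B" and \<psi>_scale: "\<psi> (scaleC_bop c A) = scaleC_bop c (\<psi> A)" for A B c
    using assms(2) unfolding positive_linear_map_def
    by (auto simp: module_hom.add[OF Vector_Spaces.linear.axioms(3)] module_hom.scale[OF Vector_Spaces.linear.axioms(3)])
  show "positive_on {1..n} (toeplitz_matrix (\<lambda>i. \<psi> (\<tau> i)))"
    unfolding positive_on_def
  proof
    fix \<xi> :: "nat \<Rightarrow> 'k"
    define c where "c k j = cinner (\<xi> k) (bop_apply (\<psi> (\<tau> (int k - int j))) (\<xi> j))" for k j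
    \<comment> \<open>The contribution of the added scalar after applying \<open>\<psi>\<close>,
      confined to the diagonal.\<close>
    define e where "e k j = (if k = j then cinner (\<xi> k) (bop_apply (\<psi> id_bop) (\<xi> j)) else 0)" for k j
    \<comment> \<open>The Fejer mean divided by \<open>N\<close>, for an extension to size
      \<open>N\<close> with perturbation \<open>\<delta> = 1 / N\<close>; the size \<open>n\<close>
      stays fixed.\<close>
    define F where "F N = (\<Sum>k=1..n. \<Sum>j=1..n. (1 - of_int \<bar>int k - int j\<bar> / of_nat N) *
      (c k j + 1 / of_nat N * e k j))" for N
    have "F N \<in> \<real>\<^sub>\<ge>\<^sub>0" if le: "n \<le> N" for N
    proof -
      have N: "N > 0"
        using le n by simp
      obtain \<sigma> where \<sigma>: "\<And>d. d \<noteq> 0 \<Longrightarrow> \<bar>d\<bar> < int n \<Longrightarrow> \<sigma> d = \<tau> d"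
        "\<sigma> 0 = \<tau> 0 + scaleC_bop (complex_of_real (1 / real N)) id_bop"
        "positive_on {1..N} (toeplitz_matrix \<sigma>)"
        using toeplitz_extend[OF n _ pos le, of "1 / real N"] N by auto
      have entry: "cinner (\<xi> k) (bop_apply (\<psi> (\<sigma> (int k - int j))) (\<xi> j)) = c k j + 1 / of_nat N * e k j"
        if "k \<in> {1..n}" "j \<in> {1..n}" for k j
      proof (cases "k = j")
        case True
        then show ?thesis
          by (simp add: \<sigma>(2) \<psi>_add \<psi>_scale c_def e_def plus_bop.rep_eq scaleC_bop.rep_eq
              cinner_add_right cinner_scaleC_right)
      next
        case False
        then have "\<sigma> (int k - int j) = \<tau> (int k - int j)"
          using that by (intro \<sigma>(1)) auto
        then show ?thesis
          using False by (simp add: c_def e_def)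
      qed
      have eq: "(\<Sum>k=1..n. \<Sum>j=1..n. of_int (int N - \<bar>int k - int j\<bar>) *
          cinner (\<xi> k) (bop_apply (\<psi> (\<sigma> (int k - int j))) (\<xi> j))) = of_nat N * F N"
        unfolding F_def sum_distrib_left
        by (intro sum.cong refl, subst entry) (use N in \<open>auto simp: field_simps\<close>)
      have "of_nat N * F N \<in> \<real>\<^sub>\<ge>\<^sub>0"
        using positive_map_fejer_mean[OF assms(2) \<sigma>(3) le, of \<xi>] unfolding eq .
      moreover have "inverse (of_nat N :: complex) \<in> \<real>\<^sub>\<ge>\<^sub>0"
        by (simp add: nonneg_Reals_inverse_I)
      ultimately have "inverse (of_nat N) * (of_nat N * F N) \<in> \<real>\<^sub>\<ge>\<^sub>0"
        by (rule nonneg_Reals_mult_I[rotated])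
      then show ?thesis
        using N by (simp flip: mult.assoc)
    qed
    then have "\<forall>\<^sub>F N in sequentially. F N \<in> \<real>\<^sub>\<ge>\<^sub>0"
      by (auto simp: eventually_sequentially)
    \<comment> \<open>\<open>F\<close> is expressed through \<open>\<tau>\<close> alone. The
      extensions \<open>\<sigma>\<close>, which may change with \<open>N\<close>, have dropped out,
      so the limit is taken term by term.\<close>
    moreover have "F \<longlonglongrightarrow> (\<Sum>k=1..n. \<Sum>j=1..n. (1 - 0) * (c k j + 0 * e k j))"
      unfolding F_def by (intro tendsto_intros lim_const_over_n lim_1_over_n)
    ultimately have "(\<Sum>k=1..n. \<Sum>j=1..n. (1 - 0) * (c k j + 0 * e k j)) \<in> \<real>\<^sub>\<ge>\<^sub>0"
      by (intro Lim_in_closed_set[OF closed_nonneg_Reals_complex]) auto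
    then show "sform {1..n} (toeplitz_matrix (\<lambda>i. \<psi> (\<tau> i))) \<xi> \<xi> \<in> \<real>\<^sub>\<ge>\<^sub>0"
      by (simp add: sform_def toeplitz_matrix_def c_def)
  qed
qed

end
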